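(* $\mathcal{S}_{3s}(2,3)=\mathbb{N}\setminus\{1,2,3,4,5,7\}$.
   Context: Let $V$ be a set of $v$ elements and let $k,t$ be positive integers with $t<k<v$. A block is a $k$-subset of $V$. A $\mu$-way $(v,k,t)$ trade of volume $m$ is a family $T=\{T_1,\dots,T_\mu\}$ of $\mu$ pairwise disjoint collections of blocks, each $T_i$ consisting of exactly $m$ blocks, such that for every $t$-subset $S$ of $V$, the number of blocks of $T_i$ containing $S$ is the same for all $i$. It is a Steiner trade if every $t$-subset of $V$ is contained in at most one block of each $T_i$. $\mathcal{S}_{\mu s}(t,k)$ denotes the set of all positive integers $m$ such that a $\mu$-way $(v,k,t)$ Steiner trade of volume $m$ exists for some $v$. Here $\mathbb{N}=\{1,2,3,\dots\}$. *)

theory Defs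
  imports Main
begin

definition blocks :: "'a set \<Rightarrow> nat \<Rightarrow> 'a set set" where
  "blocks V k = {B. B \<subseteq> V \<and> card B = k}"

text \<open>The family \<open>{T\<^sub>1, \<dots>, T\<^sub>\<mu>}\<close> is given as a function on the indices \<open>1, \<dots>, \<mu>\<close>;
  its values at other indices are irrelevant.\<close>

definition way_trade ::
  "nat \<Rightarrow> 'a set \<Rightarrow> nat \<Rightarrow> nat \<Rightarrow> nat \<Rightarrow> nat \<Rightarrow> (nat \<Rightarrow> 'a set set) \<Rightarrow> bool" where
  "way_trade \<mu> V v k t m T \<longleftrightarrow>
     finite V \<and> card V = v \<and> 0 < t \<and> t < k \<and> k < v \<and>
     (\<forall>i\<in>{1..\<mu>}. T i \<subseteq> blocks V k \<and> card (T i) = m) \<and>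
     (\<forall>i\<in>{1..\<mu>}. \<forall>j\<in>{1..\<mu>}. i \<noteq> j \<longrightarrow> T i \<inter> T j = {}) \<and>
     (\<forall>S. S \<subseteq> V \<and> card S = t \<longrightarrow>
        (\<forall>i\<in>{1..\<mu>}. \<forall>j\<in>{1..\<mu>}. card {B \<in> T i. S \<subseteq> B} = card {B \<in> T j. S \<subseteq> B}))"

definition steiner_trade ::
  "nat \<Rightarrow> 'a set \<Rightarrow> nat \<Rightarrow> nat \<Rightarrow> nat \<Rightarrow> nat \<Rightarrow> (nat \<Rightarrow> 'a set set) \<Rightarrow> bool" where
  "steiner_trade \<mu> V v k t m T \<longleftrightarrow>
     way_trade \<mu> V v k t m T \<and>
     (\<forall>S. S \<subseteq> V \<and> card S = t \<longrightarrow> (\<forall>i\<in>{1..\<mu>}. card {B \<in> T i. S \<subseteq> B} \<le> 1))"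

text \<open>Since \<open>V\<close> is finite and only its cardinality matters, it loses no generality to take
  the points to be natural numbers.\<close>

definition steiner_volumes :: "nat \<Rightarrow> nat \<Rightarrow> nat \<Rightarrow> nat set" where
  "steiner_volumes \<mu> t k =
     {m. 0 < m \<and> (\<exists>v (V :: nat set) T. steiner_trade \<mu> V v k t m T)}"

end

theory Submission
  imports Defs
begin

text \<open>Existence: disjoint unions make the set of volumes closed under addition, so trades of
  volumes 6, 8, 9, 10, 11 and 13 suffice.

  Non-existence: a point lying in \<open>r > 0\<close> blocks of each part has \<open>r \<ge> 2\<close>. If \<open>r = 2\<close>, its four
  neighbours are pairwise joined, which forces four further blocks; a seventh block can never
  complete the trade. If \<open>r \<ge> 3\<close> everywhere, there are at least seven points, and counting
  incidences gives at most \<open>m\<close> points; for \<open>m = 7\<close> the three parts would be pairwise disjoint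
  Fano planes on the same seven points, which do not exist.\<close>

section \<open>Three-way Steiner triple trades described by covered pairs\<close>

definition covers :: "'a set set \<Rightarrow> 'a \<Rightarrow> 'a \<Rightarrow> bool" where
  "covers A u v \<longleftrightarrow> (\<exists>B\<in>A. u \<in> B \<and> v \<in> B)"

text \<open>In a Steiner trade every pair count is 0 or 1, so equal counts mean that the parts cover
  the same pairs. Stated this way the ground set disappears and no cardinalities of block families
  through a pair remain. The one-sided implication in the last clause suffices because
  \<open>i\<close> and \<open>j\<close> range over both orders.\<close>

definition trade3 :: "nat \<Rightarrow> (nat \<Rightarrow> 'a set set) \<Rightarrow> bool" where
  "trade3 m T \<longleftrightarrow>
     (\<forall>i\<in>{1..3}. finite (T i) \<and> card (T i) = m \<and> (\<forall>B\<in>T i. card B = 3)) \<and>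
     (\<forall>i\<in>{1..3}. \<forall>B\<in>T i. \<forall>B'\<in>T i. \<forall>u v.
        u \<noteq> v \<and> u \<in> B \<and> v \<in> B \<and> u \<in> B' \<and> v \<in> B' \<longrightarrow> B = B') \<and>
     (\<forall>i\<in>{1..3}. \<forall>j\<in>{1..3}. i \<noteq> j \<longrightarrow> T i \<inter> T j = {}) \<and>
     (\<forall>i\<in>{1..3}. \<forall>j\<in>{1..3}. \<forall>u v. u \<noteq> v \<longrightarrow> covers (T i) u v \<longrightarrow> covers (T j) u v)"

lemma trade3I:
  assumes "\<And>i. i \<in> {1..3} \<Longrightarrow> finite (T i)"
    and "\<And>i. i \<in> {1..3} \<Longrightarrow> card (T i) = m"
    and "\<And>i B. i \<in> {1..3} \<Longrightarrow> B \<in> T i \<Longrightarrow> card B = 3"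
    and "\<And>i B B' u v. i \<in> {1..3} \<Longrightarrow> B \<in> T i \<Longrightarrow> B' \<in> T i \<Longrightarrow> u \<noteq> v \<Longrightarrow>
      u \<in> B \<Longrightarrow> v \<in> B \<Longrightarrow> u \<in> B' \<Longrightarrow> v \<in> B' \<Longrightarrow> B = B'"
    and "\<And>i j. i \<in> {1..3} \<Longrightarrow> j \<in> {1..3} \<Longrightarrow> i \<noteq> j \<Longrightarrow> T i \<inter> T j = {}"
    and "\<And>i j u v. i \<in> {1..3} \<Longrightarrow> j \<in> {1..3} \<Longrightarrow> u \<noteq> v \<Longrightarrow> covers (T i) u v \<Longrightarrow> covers (T j) u v"
  shows "trade3 m T"
  unfolding trade3_def
  by (intro conjI ballI allI impI; (elim conjE)?; rule assms; assumption)

lemma trade3D: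
  assumes "trade3 m T" "i \<in> {1..3}"
  shows trade3_finite: "finite (T i)"
    and trade3_card: "card (T i) = m"
    and trade3_card_block: "B \<in> T i \<Longrightarrow> card B = 3"
    and trade3_unique: "B \<in> T i \<Longrightarrow> B' \<in> T i \<Longrightarrow> u \<noteq> v \<Longrightarrow>
      u \<in> B \<Longrightarrow> v \<in> B \<Longrightarrow> u \<in> B' \<Longrightarrow> v \<in> B' \<Longrightarrow> B = B'"
    and trade3_disjoint: "j \<in> {1..3} \<Longrightarrow> i \<noteq> j \<Longrightarrow> T i \<inter> T j = {}"
    and trade3_covers: "j \<in> {1..3} \<Longrightarrow> u \<noteq> v \<Longrightarrow> covers (T i) u v \<Longrightarrow> covers (T j) u v"
proof -
  note T = assms(1)[unfolded trade3_def]
  show "finite (T i)" "card (T i) = m" "B \<in> T i \<Longrightarrow> card B = 3"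
    using T assms(2) by simp_all
  show "B \<in> T i \<Longrightarrow> B' \<in> T i \<Longrightarrow> u \<noteq> v \<Longrightarrow>
      u \<in> B \<Longrightarrow> v \<in> B \<Longrightarrow> u \<in> B' \<Longrightarrow> v \<in> B' \<Longrightarrow> B = B'"
    using T[THEN conjunct2, THEN conjunct1] assms(2) by blast
  show "j \<in> {1..3} \<Longrightarrow> i \<noteq> j \<Longrightarrow> T i \<inter> T j = {}"
    using T[THEN conjunct2, THEN conjunct2, THEN conjunct1] assms(2) by blast
  show "j \<in> {1..3} \<Longrightarrow> u \<noteq> v \<Longrightarrow> covers (T i) u v \<Longrightarrow> covers (T j) u v"
    using T[THEN conjunct2, THEN conjunct2, THEN conjunct2] assms(2) by blast
qed

lemma trade3_if_steiner_trade:
  assumes "steiner_trade 3 V v 3 2 m T"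
  shows "trade3 m T"
proof -
  have way: "way_trade 3 V v 3 2 m T"
    and le: "\<And>S i. S \<subseteq> V \<Longrightarrow> card S = 2 \<Longrightarrow> i \<in> {1..3} \<Longrightarrow> card {B \<in> T i. S \<subseteq> B} \<le> 1"
    using assms unfolding steiner_trade_def by auto
  have fV: "finite V"
    and "\<forall>i\<in>{1..3}. T i \<subseteq> blocks V 3 \<and> card (T i) = m"
    and "\<forall>i\<in>{1..3}. \<forall>j\<in>{1..3}. i \<noteq> j \<longrightarrow> T i \<inter> T j = {}"
    and "\<forall>S. S \<subseteq> V \<and> card S = 2 \<longrightarrow>
      (\<forall>i\<in>{1..3}. \<forall>j\<in>{1..3}. card {B \<in> T i. S \<subseteq> B} = card {B \<in> T j. S \<subseteq> B})"
    using way unfolding way_trade_def by - (elim conjE, assumption)+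
  then have bl: "\<And>i. i \<in> {1..3} \<Longrightarrow> T i \<subseteq> blocks V 3"
    and cm: "\<And>i. i \<in> {1..3} \<Longrightarrow> card (T i) = m"
    and dj: "\<And>i j. i \<in> {1..3} \<Longrightarrow> j \<in> {1..3} \<Longrightarrow> i \<noteq> j \<Longrightarrow> T i \<inter> T j = {}"
    and eq: "\<And>S i j. S \<subseteq> V \<Longrightarrow> card S = 2 \<Longrightarrow> i \<in> {1..3} \<Longrightarrow> j \<in> {1..3} \<Longrightarrow>
      card {B \<in> T i. S \<subseteq> B} = card {B \<in> T j. S \<subseteq> B}"
    by blast+
  have fin: "finite (T i)" if "i \<in> {1..3}" for i
    using bl[OF that] fV by (auto simp: blocks_def intro: finite_subset[of _ "Pow V"])
  have uniq: "B = B'"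
    if "i \<in> {1..3}" "B \<in> T i" "B' \<in> T i" "u \<noteq> v" "u \<in> B" "v \<in> B" "u \<in> B'" "v \<in> B'"
    for i B B' u v
  proof -
    have "{u, v} \<subseteq> V" using bl[OF that(1)] that by (auto simp: blocks_def)
    then have "card {B \<in> T i. {u, v} \<subseteq> B} \<le> Suc 0" using le[of "{u, v}" i] that by simp
    moreover have "finite {B \<in> T i. {u, v} \<subseteq> B}" using fin[OF that(1)] by simp
    ultimately show ?thesis using that by (auto simp: card_le_Suc0_iff_eq)
  qed
  have cov: "covers (T j) u v"
    if "i \<in> {1..3}" "j \<in> {1..3}" "u \<noteq> v" and c: "covers (T i) u v" for i j u v
  proof -
    obtain B where B: "B \<in> T i" "{u, v} \<subseteq> B"
      using c unfolding covers_def by blast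
    then have "{u, v} \<subseteq> V" using bl[OF that(1)] by (auto simp: blocks_def)
    then have "card {B \<in> T i. {u, v} \<subseteq> B} = card {B \<in> T j. {u, v} \<subseteq> B}"
      using eq[of "{u, v}" i j] that by simp
    moreover have "card {B \<in> T i. {u, v} \<subseteq> B} \<noteq> 0" using B fin[OF that(1)] by auto
    ultimately have "card {B \<in> T j. {u, v} \<subseteq> B} \<noteq> 0" by (simp only: not_False_eq_True)
    then have "{B \<in> T j. {u, v} \<subseteq> B} \<noteq> {}" by (metis card.empty)
    then show ?thesis by (auto simp: covers_def)
  qed
  have "card B = 3" if "i \<in> {1..3}" "B \<in> T i" for i B
    using bl that by (auto simp: blocks_def)
  then show ?thesis
    using fin cm dj uniq cov by (intro trade3I)
qed

text \<open>This 0-1 value delivers both the equality of the counts and the Steiner bound when going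
  back from \<open>trade3\<close> to \<open>steiner_trade\<close>.\<close>

lemma card_blocks_through_pair:
  assumes "trade3 m T" "i \<in> {1..3}" "u \<noteq> v"
  shows "card {B \<in> T i. {u, v} \<subseteq> B} = (if covers (T i) u v then 1 else 0)"
proof (cases "covers (T i) u v")
  case True
  then obtain B where "B \<in> T i" "u \<in> B" "v \<in> B" by (auto simp: covers_def)
  then have "{B \<in> T i. {u, v} \<subseteq> B} = {B}"
    using trade3_unique[OF assms(1,2) _ _ assms(3)] by blast
  with True show ?thesis by simp
next
  case False
  then have "{B \<in> T i. {u, v} \<subseteq> B} = {}" by (auto simp: covers_def)
  with False show ?thesis by (simp only: card.empty if_False)
qed

lemma steiner_trade_if_trade3:
  fixes T :: "nat \<Rightarrow> nat set set"
  assumes T: "trade3 m T"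
  shows "\<exists>v (V :: nat set). steiner_trade 3 V v 3 2 m T"
proof -
  have fin: "finite (T i)" "\<And>B. B \<in> T i \<Longrightarrow> card B = 3" "card (T i) = m" if "i \<in> {1..3}" for i
    using trade3D[OF T that] by simp_all
  have "finite B" if "i \<in> {1..3}" "B \<in> T i" for i B
    using fin(2)[OF that] by (simp add: card_ge_0_finite)
  then have "finite (\<Union>i\<in>{1..3}. \<Union>(T i))"
    using fin(1) by blast
  then obtain n where n: "(\<Union>i\<in>{1..3}. \<Union>(T i)) \<subseteq> {..n}"
    by (auto simp: finite_nat_set_iff_bounded_le)
  \<comment> \<open>All points are at most \<open>n\<close>; the interval is extended to
    \<open>n + 3\<close> so that it has \<open>n + 4\<close> elements, which exceeds the block size
    3 even for \<open>n = 0\<close>.\<close>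
  have bl: "T i \<subseteq> blocks {..n + 3} 3" if "i \<in> {1..3}" for i
    using n fin that unfolding blocks_def by fastforce
  have dj: "T i \<inter> T j = {}" if "i \<in> {1..3}" "j \<in> {1..3}" "i \<noteq> j" for i j
    using trade3_disjoint[OF T that(1,2,3)] .
  have eq: "card {B \<in> T i. S \<subseteq> B} = card {B \<in> T j. S \<subseteq> B}" and le: "card {B \<in> T i. S \<subseteq> B} \<le> 1"
    if S: "card S = 2" and ij: "i \<in> {1..3}" "j \<in> {1..3}" for S i j
  proof -
    obtain u v where uv: "S = {u, v}" "u \<noteq> v" using S by (auto simp: card_2_iff)
    have "covers (T i) u v \<longleftrightarrow> covers (T j) u v"
      using trade3_covers[OF T] ij uv(2) by blast
    then show "card {B \<in> T i. S \<subseteq> B} = card {B \<in> T j. S \<subseteq> B}" "card {B \<in> T i. S \<subseteq> B} \<le> 1"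
      unfolding uv(1) using card_blocks_through_pair[OF T _ uv(2)] ij by simp_all
  qed
  have "steiner_trade 3 {..n + 3} (n + 4) 3 2 m T"
    unfolding steiner_trade_def way_trade_def
    by (intro conjI ballI allI impI; (elim conjE)?;
        (rule bl fin(3) dj eq le; assumption | simp))
  then show ?thesis by blast
qed

lemma mem_steiner_volumes_iff:
  "m \<in> steiner_volumes 3 2 3 \<longleftrightarrow> 0 < m \<and> (\<exists>T :: nat \<Rightarrow> nat set set. trade3 m T)"
  unfolding steiner_volumes_def
  using trade3_if_steiner_trade steiner_trade_if_trade3 by blast


section \<open>Constructions\<close>

lemma covers_image_iff:
  assumes "inj f"
  shows "covers ((`) f ` A) u v \<longleftrightarrow> (\<exists>x y. u = f x \<and> v = f y \<and> covers A x y)"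
  unfolding covers_def using assms by (auto simp: inj_def)

text \<open>Relabelling of points; it serves to move two trades onto disjoint point sets.\<close>

lemma trade3_image:
  assumes T: "trade3 m T" and f: "inj f"
  shows "trade3 m (\<lambda>i. (`) f ` T i)"
proof -
  have fin: "finite (T i)" "\<And>B. B \<in> T i \<Longrightarrow> card B = 3" "card (T i) = m" if "i \<in> {1..3}" for i
    using trade3D[OF T that] by simp_all
  have inj: "inj ((`) f)" using f by (rule inj_on_image[OF inj_on_subset]) simp
  have "finite ((`) f ` T i)" if "i \<in> {1..3}" for i
    using fin(1)[OF that] by simp
  moreover have "card ((`) f ` T i) = m" if "i \<in> {1..3}" for i
    using fin[OF that] inj by (simp add: card_image inj_on_subset)
  moreover have "card B = 3" if "i \<in> {1..3}" "B \<in> (`) f ` T i" for i B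
    using that fin f by (auto simp: card_image inj_on_subset)
  moreover have "B = B'"
    if B: "i \<in> {1..3}" "B \<in> (`) f ` T i" "B' \<in> (`) f ` T i"
      and uv: "u \<noteq> v" "u \<in> B" "v \<in> B" "u \<in> B'" "v \<in> B'" for i B B' u v
  proof -
    obtain C C' where C: "C \<in> T i" "C' \<in> T i" "B = f ` C" "B' = f ` C'" using B by blast
    obtain x y where "u = f x" "v = f y" "x \<in> C" "y \<in> C" using uv C by blast
    with uv C f have "x \<noteq> y" "x \<in> C'" "y \<in> C'" by (auto simp: inj_image_mem_iff)
    then have "C = C'" using trade3_unique[OF T B(1) C(1,2)] \<open>x \<in> C\<close> \<open>y \<in> C\<close> by blast
    with C show ?thesis by simp
  qed
  moreover have "((`) f ` T i) \<inter> ((`) f ` T j) = {}"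
    if "i \<in> {1..3}" "j \<in> {1..3}" "i \<noteq> j" for i j
  proof -
    have "T i \<inter> T j = {}" using trade3_disjoint[OF T that] .
    then show ?thesis using inj by (simp flip: image_Int)
  qed
  moreover have "covers ((`) f ` T j) u v"
    if ij: "i \<in> {1..3}" "j \<in> {1..3}" and uv: "u \<noteq> v" "covers ((`) f ` T i) u v" for i j u v
  proof -
    obtain x y where "u = f x" "v = f y" "covers (T i) x y"
      using uv(2) f by (auto simp: covers_image_iff)
    moreover have "covers (T j) x y"
      using trade3_covers[OF T ij, of x y] calculation uv(1) by blast
    ultimately show ?thesis using f by (auto simp: covers_image_iff)
  qed
  ultimately show ?thesis by (rule trade3I)
qed

text \<open>A block of \<open>T\<close> never meets a block of \<open>U\<close>, so two blocks of
  the union that share a point come from the same trade, and each property is inherited from that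
  trade.\<close>

lemma trade3_disjoint_Un:
  assumes T: "trade3 m T" and U: "trade3 n U"
    and disj: "\<And>i j B C. i \<in> {1..3} \<Longrightarrow> j \<in> {1..3} \<Longrightarrow> B \<in> T i \<Longrightarrow> C \<in> U j \<Longrightarrow> B \<inter> C = {}"
  shows "trade3 (m + n) (\<lambda>i. T i \<union> U i)"
proof -
  have fin: "finite (T i)" "\<And>B. B \<in> T i \<Longrightarrow> card B = 3" "card (T i) = m"
    "finite (U i)" "\<And>B. B \<in> U i \<Longrightarrow> card B = 3" "card (U i) = n" if "i \<in> {1..3}" for i
    using trade3D[OF T that] trade3D[OF U that] by simp_all
  \<comment> \<open>A common block would be disjoint from itself, hence empty, although it has three
    points.\<close>
  have TU: "T i \<inter> U j = {}" if "i \<in> {1..3}" "j \<in> {1..3}" for i j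
  proof (rule ccontr)
    assume "T i \<inter> U j \<noteq> {}"
    then obtain B where B: "B \<in> T i" "B \<in> U j" by blast
    then have "B = {}" using disj that by blast
    with fin(2)[OF that(1) B(1)] show False by simp
  qed
  have "finite (T i \<union> U i)" if "i \<in> {1..3}" for i
    using fin(1,4)[OF that] by simp
  moreover have "card (T i \<union> U i) = m + n" if "i \<in> {1..3}" for i
    using fin[OF that] TU[OF that that] by (simp add: card_Un_disjoint)
  moreover have "card B = 3" if "i \<in> {1..3}" "B \<in> T i \<union> U i" for i B
    using fin(2,5)[OF that(1)] that(2) by blast
  moreover have "B = B'"
    if B: "i \<in> {1..3}" "B \<in> T i \<union> U i" "B' \<in> T i \<union> U i"
      and uv: "u \<noteq> v" "u \<in> B" "v \<in> B" "u \<in> B'" "v \<in> B'" for i B B' u v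
  proof -
    have "B \<in> T i \<and> B' \<in> T i \<or> B \<in> U i \<and> B' \<in> U i"
      using B uv disj[OF B(1) B(1)] by blast
    then show ?thesis using trade3_unique[OF T B(1)] trade3_unique[OF U B(1)] uv by metis
  qed
  moreover have "(T i \<union> U i) \<inter> (T j \<union> U j) = {}"
    if "i \<in> {1..3}" "j \<in> {1..3}" "i \<noteq> j" for i j
  proof -
    have "T i \<inter> T j = {}" "U i \<inter> U j = {}" using trade3_disjoint[OF T that] trade3_disjoint[OF U that] .
    then show ?thesis using TU that by blast
  qed
  moreover have "covers (T j \<union> U j) u v"
    if ij: "i \<in> {1..3}" "j \<in> {1..3}" and uv: "u \<noteq> v" "covers (T i \<union> U i) u v" for i j u v
  proof -
    have "covers (T i) u v \<or> covers (U i) u v" using uv by (auto simp: covers_def)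
    then have "covers (T j) u v \<or> covers (U j) u v"
      using trade3_covers[OF T ij uv(1)] trade3_covers[OF U ij uv(1)] by blast
    then show ?thesis by (auto simp: covers_def)
  qed
  ultimately show ?thesis by (rule trade3I)
qed

lemma steiner_volumes_add:
  assumes "m \<in> steiner_volumes 3 2 3" "n \<in> steiner_volumes 3 2 3"
  shows "m + n \<in> steiner_volumes 3 2 3"
proof -
  obtain T U :: "nat \<Rightarrow> nat set set" where T: "trade3 m T" and U: "trade3 n U"
    using assms by (auto simp: mem_steiner_volumes_iff)
  \<comment> \<open>One trade is moved to the even numbers and the other to the odd numbers, which
    makes their blocks disjoint.\<close>
  have "inj (\<lambda>x::nat. 2 * x)" "inj (\<lambda>x::nat. 2 * x + 1)" by (auto simp: inj_def)
  then have "trade3 (m + n)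
    (\<lambda>i. (`) (\<lambda>x. 2 * x) ` T i \<union> (`) (\<lambda>x. 2 * x + 1) ` U i)"
    by (intro trade3_disjoint_Un trade3_image T U) (auto, presburger)
  then show ?thesis using assms by (auto simp: mem_steiner_volumes_iff)
qed

section \<open>Checking explicit trades given as lists of triples\<close>

type_synonym triple = "nat \<times> nat \<times> nat"

definition points :: "triple \<Rightarrow> nat set" where
  "points = (\<lambda>(a, b, c). {a, b, c})"

definition pairs :: "triple list \<Rightarrow> (nat \<times> nat) list" where
  "pairs xs = concat (map (\<lambda>(a, b, c). [(a, b), (a, c), (b, c)]) xs)"

definition increasing :: "triple \<Rightarrow> bool" where
  "increasing = (\<lambda>(a, b, c). a < b \<and> b < c)"

text \<open>An executable certificate. Increasing triples represent each block once and list each of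
  its pairs with the smaller point first. Hence \<open>distinct (pairs xs)\<close> expresses the
  Steiner property, and inclusion of the pair lists in all directions says that the same pairs are
  covered.\<close>

definition check_trade :: "nat \<Rightarrow> triple list \<Rightarrow> triple list \<Rightarrow> triple list \<Rightarrow> bool" where
  "check_trade m A B C \<longleftrightarrow>
     (\<forall>xs\<in>set [A, B, C]. length xs = m \<and> list_all increasing xs \<and> distinct (pairs xs) \<and>
        (\<forall>ys\<in>set [A, B, C]. list_all (\<lambda>p. p \<in> set (pairs ys)) (pairs xs))) \<and>
     list_all (\<lambda>x. x \<notin> set B \<and> x \<notin> set C) A \<and> list_all (\<lambda>x. x \<notin> set C) B"

lemma inj_on_points: "inj_on points {x. increasing x}"
proof (rule inj_on_inverseI)
  fix x assume "x \<in> {x. increasing x}"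
  \<comment> \<open>The inverse reads the triple off its set: the middle entry is what remains of
    the sum after removing minimum and maximum.\<close>
  then show "(\<lambda>X. (Min X, \<Sum>X - Min X - Max X, Max X)) (points x) = x"
    by (cases x) (auto simp: points_def increasing_def)
qed

lemma pairs_Cons:
  "pairs ((a, b, c) # xs) = (a, b) # (a, c) # (b, c) # pairs xs"
  by (simp add: pairs_def)

lemma distinct_if_distinct_pairs: "distinct (pairs xs) \<Longrightarrow> distinct xs"
proof (induction xs)
  case (Cons x xs)
  obtain a b c where x: "x = (a, b, c)" by (cases x)
  have "(a, b) \<in> set (pairs xs)" if "x \<in> set xs" using that x by (force simp: pairs_def)
  then show ?case using Cons x by (auto simp: pairs_Cons)
qed simp

text \<open>The Steiner property on the level of lists: a pair belonging to two different entries
  would occur twice in the concatenation \<open>pairs xs\<close>.\<close>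

lemma pair_determines_triple:
  assumes "distinct (pairs xs)" "x \<in> set xs" "y \<in> set xs" "p \<in> set (pairs [x])" "p \<in> set (pairs [y])"
  shows "x = y"
  using assms
proof (induction xs)
  case (Cons z zs)
  have app: "pairs (z # zs) = pairs [z] @ pairs zs" by (simp add: pairs_def)
  have "p \<in> set (pairs zs)" if "w \<in> set zs" "p \<in> set (pairs [w])" for w
    using that by (auto simp: pairs_def)
  then show ?case using Cons unfolding app by fastforce
qed simp

lemma mem_pairs_singleton_iff:
  assumes "increasing x" "u < v"
  shows "(u, v) \<in> set (pairs [x]) \<longleftrightarrow> u \<in> points x \<and> v \<in> points x"
  using assms by (cases x) (auto simp: pairs_def points_def increasing_def)

lemma covers_iff_mem_pairs:
  assumes "list_all increasing xs" "u < v"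
  shows "covers (points ` set xs) u v \<longleftrightarrow> (u, v) \<in> set (pairs xs)"
proof -
  have "(u, v) \<in> set (pairs xs) \<longleftrightarrow> (\<exists>x\<in>set xs. (u, v) \<in> set (pairs [x]))"
    by (auto simp: pairs_def)
  also have "\<dots> \<longleftrightarrow> (\<exists>x\<in>set xs. u \<in> points x \<and> v \<in> points x)"
    using assms mem_pairs_singleton_iff by (auto simp: list_all_iff)
  finally show ?thesis by (auto simp: covers_def)
qed

lemma covers_commute: "covers A u v \<longleftrightarrow> covers A v u"
  by (auto simp: covers_def)

lemma steiner_volumes_if_check:
  assumes chk: "check_trade m A B C" and m: "0 < m"
  shows "m \<in> steiner_volumes 3 2 3"
proof -
  \<comment> \<open>The parts of a trade are indexed from 1, list positions from 0; hence
    \<open>i - 1\<close>.\<close>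
  define L where "L i = [A, B, C] ! (i - 1)" for i :: nat
  have I: "i \<in> {1..3} \<longleftrightarrow> i = 1 \<or> i = 2 \<or> i = 3" for i :: nat by auto
  have Lset: "L i \<in> set [A, B, C]" if "i \<in> {1..3}" for i
    using that unfolding I by (auto simp: L_def)
  have props: "length (L i) = m" "list_all increasing (L i)" "distinct (pairs (L i))"
    and sub: "j \<in> {1..3} \<Longrightarrow> set (pairs (L i)) \<subseteq> set (pairs (L j))" if "i \<in> {1..3}" for i j
    using chk Lset that unfolding check_trade_def list_all_iff by blast+
  have "set A \<inter> set B = {}" "set A \<inter> set C = {}" "set B \<inter> set C = {}"
    using chk unfolding check_trade_def list_all_iff by auto
  then have disj: "set (L i) \<inter> set (L j) = {}" if "i \<in> {1..3}" "j \<in> {1..3}" "i \<noteq> j" for i j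
    using that unfolding I by (elim disjE; simp add: L_def Int_commute)
  define T where "T i = points ` set (L i)" for i
  have inj: "inj_on points (set (L i) \<union> set (L j))" if "i \<in> {1..3}" "j \<in> {1..3}" for i j
    by (rule inj_on_subset[OF inj_on_points]) (use props that in \<open>auto simp: list_all_iff\<close>)
  have "finite (T i)" for i by (simp add: T_def)
  moreover have "card (T i) = m" if "i \<in> {1..3}" for i
    using props[OF that] inj[OF that that]
    by (simp add: T_def card_image distinct_card distinct_if_distinct_pairs)
  moreover have "card X = 3" if "i \<in> {1..3}" "X \<in> T i" for i X
    using props[OF that(1)] that(2)
    by (auto simp: T_def list_all_iff points_def increasing_def)
  moreover have "X = X'"
    if i: "i \<in> {1..3}" and X: "X \<in> T i" "X' \<in> T i"
      and uv: "u \<noteq> v" "u \<in> X" "v \<in> X" "u \<in> X'" "v \<in> X'" for i X X' u v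
  proof -
    obtain x x' where x: "x \<in> set (L i)" "x' \<in> set (L i)" "X = points x" "X' = points x'"
      using X by (auto simp: T_def)
    then have "increasing x" "increasing x'" using props[OF i] by (auto simp: list_all_iff)
    \<comment> \<open>The witness is \<open>(u, v)\<close> or \<open>(v, u)\<close>, whichever is in
      increasing order.\<close>
    then have "\<exists>p. p \<in> set (pairs [x]) \<and> p \<in> set (pairs [x'])"
      using uv x mem_pairs_singleton_iff by (metis linorder_neqE_nat)
    then show ?thesis using x pair_determines_triple props(3)[OF i] by blast
  qed
  moreover have "T i \<inter> T j = {}" if "i \<in> {1..3}" "j \<in> {1..3}" "i \<noteq> j" for i j
  proof -
    have "T i \<inter> T j = points ` (set (L i) \<inter> set (L j))"
      unfolding T_def using inj[OF that(1,2)] by (intro inj_on_image_Int[symmetric]) auto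
    then show ?thesis using disj[OF that] by simp
  qed
  moreover have "covers (T j) u v"
    if ij: "i \<in> {1..3}" "j \<in> {1..3}" and uv: "u \<noteq> v" "covers (T i) u v" for i j u v
  proof -
    have "covers (T j) u v" if "u < v" "covers (T i) u v" for u v
      using that ij props(2) sub[OF ij(1,2)] covers_iff_mem_pairs unfolding T_def by blast
    then show ?thesis using uv covers_commute by (metis linorder_neqE_nat)
  qed
  ultimately have "trade3 m T"
    by (rule trade3I)
  then show ?thesis using m by (auto simp: mem_steiner_volumes_iff)
qed

text \<open>Adding the block {1, 5, 6} to each part gives three Fano planes on {0, ..., 6} that
  share exactly this line.\<close>

lemma steiner_volumes_6: "6 \<in> steiner_volumes 3 2 3"
  by (rule steiner_volumes_if_check[of _
      "[(0, 1, 2), (0, 3, 5), (0, 4, 6), (1, 3, 4), (2, 3, 6), (2, 4, 5)]"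
      "[(0, 1, 3), (0, 2, 6), (0, 4, 5), (1, 2, 4), (2, 3, 5), (3, 4, 6)]"
      "[(0, 1, 4), (0, 2, 5), (0, 3, 6), (1, 2, 3), (2, 4, 6), (3, 4, 5)]"]) code_simp+

text \<open>Each part covers all pairs of {0, ..., 7} except the perfect matching 05, 17, 23,
  46.\<close>

lemma steiner_volumes_8: "8 \<in> steiner_volumes 3 2 3"
  by (rule steiner_volumes_if_check[of _
      "[(0, 1, 2), (0, 3, 4), (0, 6, 7), (1, 3, 6), (1, 4, 5), (2, 4, 7), (2, 5, 6), (3, 5,
       7)]"
      "[(0, 1, 3), (0, 2, 6), (0, 4, 7), (1, 2, 4), (1, 5, 6), (2, 5, 7), (3, 4, 5), (3, 6,
       7)]"
      "[(0, 1, 4), (0, 2, 7), (0, 3, 6), (1, 2, 6), (1, 3, 5), (2, 4, 5), (3, 4, 7), (5, 6,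
       7)]"]) code_simp+

lemma steiner_volumes_9: "9 \<in> steiner_volumes 3 2 3"
  by (rule steiner_volumes_if_check[of _
      "[(0, 1, 2), (0, 5, 7), (0, 6, 8), (1, 3, 7), (1, 4, 5), (2, 3, 6), (2, 4, 8), (3, 5,
       8), (4, 6, 7)]"
      "[(0, 1, 5), (0, 2, 8), (0, 6, 7), (1, 2, 3), (1, 4, 7), (2, 4, 6), (3, 5, 7), (3, 6,
       8), (4, 5, 8)]"
      "[(0, 1, 7), (0, 2, 6), (0, 5, 8), (1, 2, 4), (1, 3, 5), (2, 3, 8), (3, 6, 7), (4, 5,
       7), (4, 6, 8)]"]) code_simp+

lemma steiner_volumes_10: "10 \<in> steiner_volumes 3 2 3"
  by (rule steiner_volumes_if_check[of _
      "[(0, 1, 8), (0, 2, 5), (0, 3, 6), (1, 2, 3), (1, 6, 7), (2, 4, 7), (2, 6, 8), (3, 4,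
       8), (3, 5, 7), (4, 5, 6)]"
      "[(0, 1, 6), (0, 2, 8), (0, 3, 5), (1, 2, 7), (1, 3, 8), (2, 3, 6), (2, 4, 5), (3, 4,
       7), (4, 6, 8), (5, 6, 7)]"
      "[(0, 1, 2), (0, 3, 8), (0, 5, 6), (1, 3, 7), (1, 6, 8), (2, 3, 5), (2, 4, 8), (2, 6,
       7), (3, 4, 6), (4, 5, 7)]"]) code_simp+

text \<open>Adding the block {0, 7, 8} to each part gives three Steiner triple systems on {0, ...,
  8} that share exactly this block.\<close>

lemma steiner_volumes_11: "11 \<in> steiner_volumes 3 2 3"
  by (rule steiner_volumes_if_check[of _
      "[(0, 1, 2), (0, 3, 4), (0, 5, 6), (1, 3, 8), (1, 4, 5), (1, 6, 7), (2, 3, 6), (2, 4,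
       7), (2, 5, 8), (3, 5, 7), (4, 6, 8)]"
      "[(0, 1, 3), (0, 2, 5), (0, 4, 6), (1, 2, 7), (1, 4, 8), (1, 5, 6), (2, 3, 4), (2, 6,
       8), (3, 5, 8), (3, 6, 7), (4, 5, 7)]"
      "[(0, 1, 4), (0, 2, 6), (0, 3, 5), (1, 2, 8), (1, 3, 6), (1, 5, 7), (2, 3, 7), (2, 4,
       5), (3, 4, 8), (4, 6, 7), (5, 6, 8)]"]) code_simp+

lemma steiner_volumes_13: "13 \<in> steiner_volumes 3 2 3"
  by (rule steiner_volumes_if_check[of _
      "[(0, 1, 7), (0, 3, 9), (0, 4, 8), (0, 5, 6), (1, 2, 8), (1, 3, 5), (1, 6, 9), (2, 3,
       4), (2, 5, 9), (2, 6, 7), (3, 6, 8), (4, 5, 7), (7, 8, 9)]"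
      "[(0, 1, 5), (0, 3, 4), (0, 6, 7), (0, 8, 9), (1, 2, 7), (1, 3, 9), (1, 6, 8), (2, 3,
       8), (2, 4, 5), (2, 6, 9), (3, 5, 6), (4, 7, 8), (5, 7, 9)]"
      "[(0, 1, 3), (0, 4, 5), (0, 6, 8), (0, 7, 9), (1, 2, 6), (1, 5, 9), (1, 7, 8), (2, 3,
       5), (2, 4, 7), (2, 8, 9), (3, 4, 8), (3, 6, 9), (5, 6, 7)]"]) code_simp+

lemma steiner_volumes_if_ge_8:
  "8 \<le> m \<Longrightarrow> m \<in> steiner_volumes 3 2 3"
proof (induction m rule: less_induct)
  case (less m)
  show ?case
  \<comment> \<open>From 14 on, \<open>m - 6\<close> is still at least 8, so the induction
    hypothesis applies. Of the remaining values 8 to 13, only 12 is composed of smaller volumes, as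
    \<open>6 + 6\<close>.\<close>
  proof (cases "14 \<le> m")
    case True
    then have "m - 6 \<in> steiner_volumes 3 2 3" using less.IH[of "m - 6"] by simp
    then show ?thesis using steiner_volumes_add[OF steiner_volumes_6] True by fastforce
  next
    case False
    then consider "m = 8" | "m = 9" | "m = 10" | "m = 11" | "m = 6 + 6" | "m = 13"
      using less.prems by linarith
    then show ?thesis
      using steiner_volumes_8 steiner_volumes_9 steiner_volumes_10 steiner_volumes_11
        steiner_volumes_add[OF steiner_volumes_6 steiner_volumes_6] steiner_volumes_13
      by cases (simp_all only:)
  qed
qed


section \<open>Impossible volumes\<close>

text \<open>This is Cayley's result that at most two Fano planes on the same seven points are
  disjoint. Fixing the three lines of \<open>P\<close> through \<open>x\<close> merely names the
  points and removes much of the symmetry; what remains is a finite propositional problem.\<close>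

lemma no_three_disjoint_fano_planes:
  fixes V :: "'a set"
  assumes V: "V = {x, a, b, c, d, e, f}" and dist: "distinct [x, a, b, c, d, e, f]"
    and ex: "\<And>T u v. T \<in> {P, Q, R} \<Longrightarrow> u \<in> V \<Longrightarrow> v \<in> V \<Longrightarrow> u \<noteq> v \<Longrightarrow>
      \<exists>w\<in>V. w \<noteq> u \<and> w \<noteq> v \<and> {u, v, w} \<in> T"
    and unique: "\<And>T u v w z. T \<in> {P, Q, R} \<Longrightarrow> u \<noteq> v \<Longrightarrow> {u, v, w} \<in> T \<Longrightarrow> {u, v, z} \<in> T \<Longrightarrow>
      w \<noteq> u \<Longrightarrow> w \<noteq> v \<Longrightarrow> z \<noteq> u \<Longrightarrow> z \<noteq> v \<Longrightarrow> w = z"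
    and disj: "P \<inter> Q = {}" "P \<inter> R = {}" "Q \<inter> R = {}"
    and lines: "{x, a, b} \<in> P" "{x, c, d} \<in> P" "{x, e, f} \<in> P"
  shows False
proof -
  \<comment> \<open>The hypotheses are restated with all quantifiers bounded by finite sets, so that
    unfolding \<open>V\<close> turns them into finite conjunctions and disjunctions.\<close>
  have ex': "\<forall>T\<in>{P, Q, R}. \<forall>u\<in>V. \<forall>v\<in>V. u \<noteq> v \<longrightarrow>
      (\<exists>w\<in>V. w \<noteq> u \<and> w \<noteq> v \<and> {u, v, w} \<in> T)"
    using ex by blast
  have unique': "\<forall>T\<in>{P, Q, R}. \<forall>u\<in>V. \<forall>v\<in>V. u \<noteq> v \<longrightarrow>
      (\<forall>w\<in>V. \<forall>z\<in>V. w \<noteq> u \<longrightarrow> w \<noteq> v \<longrightarrow> z \<noteq> u \<longrightarrow> z \<noteq> v \<longrightarrow> w \<noteq> z \<longrightarrow>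
        {u, v, w} \<notin> T \<or> {u, v, z} \<notin> T)"
    using unique by blast
  have disj': "\<forall>u\<in>V. \<forall>v\<in>V. u \<noteq> v \<longrightarrow> (\<forall>w\<in>V. w \<noteq> u \<longrightarrow> w \<noteq> v \<longrightarrow>
      ({u, v, w} \<notin> P \<or> {u, v, w} \<notin> Q) \<and> ({u, v, w} \<notin> P \<or> {u, v, w} \<notin> R) \<and>
      ({u, v, w} \<notin> Q \<or> {u, v, w} \<notin> R))"
    using disj by blast
  have "x \<noteq> a" "x \<noteq> b" "x \<noteq> c" "x \<noteq> d" "x \<noteq> e" "x \<noteq> f" "a \<noteq> b" "a \<noteq> c" "a \<noteq> d" "a \<noteq> e" "a \<noteq> f"
    "b \<noteq> c" "b \<noteq> d" "b \<noteq> e" "b \<noteq> f" "c \<noteq> d" "c \<noteq> e" "c \<noteq> f" "d \<noteq> e" "d \<noteq> f" "e \<noteq> f"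
    using dist by auto
  note neq = this this[symmetric]
  text \<open>Ordered rewriting with \<open>insert_commute\<close> gives each of the 35 triples a single normal
    form, so that the expanded facts become propositional clauses in the atoms \<open>{u, v, w} \<in> T\<close>.\<close>
  note clauses =
    ex'[unfolded V, simplified ball_simps bex_simps neq simp_thms, simplified insert_commute]
    unique'[unfolded V, simplified ball_simps neq simp_thms, simplified insert_commute]
    disj'[unfolded V, simplified ball_simps neq simp_thms, simplified insert_commute]
    lines[simplified insert_commute]
  show False using clauses by sat
qed

section \<open>The blocks through a single point\<close>

locale three_way_trade =
  fixes T :: "nat \<Rightarrow> 'a set set" and m :: nat
  assumes trade: "trade3 m T"
begin

declare One_nat_def [simp del]

text \<open>All parts cover the same pairs, so \<open>T 1\<close> can stand for any of them;
  \<open>adj_if_block\<close> and \<open>adjE\<close> pass between \<open>adj\<close> and the blocks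
  of an arbitrary part.\<close>

definition adj :: "'a \<Rightarrow> 'a \<Rightarrow> bool" where
  "adj u v \<longleftrightarrow> u \<noteq> v \<and> covers (T 1) u v"

definition star :: "'a \<Rightarrow> 'a set set" where
  "star x = {B \<in> T 1. x \<in> B}"

lemma finite_star: "finite (star x)"
  using trade3_finite[OF trade, of 1] by (simp add: star_def)

lemma card_block: "B \<in> T 1 \<Longrightarrow> card B = 3"
  using trade3_card_block[OF trade, of 1] by simp

lemma block_unique:
  "B \<in> T 1 \<Longrightarrow> B' \<in> T 1 \<Longrightarrow> u \<noteq> v \<Longrightarrow> u \<in> B \<Longrightarrow> v \<in> B \<Longrightarrow> u \<in> B' \<Longrightarrow> v \<in> B' \<Longrightarrow> B = B'"
  by (rule trade3_unique[OF trade, of 1 B B' u v]) simp_all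

lemma adj_if_block:
  assumes "i \<in> {1..3}" "B \<in> T i" "u \<in> B" "v \<in> B" "u \<noteq> v"
  shows "adj u v"
proof -
  have "covers (T i) u v" using assms by (auto simp: covers_def)
  then show ?thesis
    using trade3_covers[OF trade assms(1), of 1] assms(5) by (simp add: adj_def)
qed

lemma adjE:
  assumes "adj u v" "i \<in> {1..3}"
  obtains w where "w \<noteq> u" "w \<noteq> v" "{u, v, w} \<in> T i"
proof -
  have "covers (T i) u v"
    using assms trade3_covers[OF trade, of 1 i] by (simp add: adj_def)
  then obtain B where B: "B \<in> T i" "u \<in> B" "v \<in> B" by (auto simp: covers_def)
  have "card B = 3" using trade3_card_block[OF trade assms(2) B(1)] .
  then have "card (B - {u, v}) = 1"
    using B assms(1) by (subst card_Diff_subset) (auto simp: adj_def)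
  then obtain w where "B - {u, v} = {w}" by (rule card_1_singletonE)
  then have "w \<noteq> u" "w \<noteq> v" "B = {u, v, w}" using B by auto
  with B(1) show ?thesis using that by blast
qed

lemma third_point_unique:
  assumes "i \<in> {1..3}" "{u, v, w} \<in> T i" "{u, v, z} \<in> T i" "u \<noteq> v" "w \<noteq> u" "w \<noteq> v" "z \<noteq> u" "z \<noteq> v"
  shows "w = z"
proof -
  have "{u, v, w} = {u, v, z}"
    by (rule trade3_unique[OF trade assms(1,2,3,4)]) auto
  then show ?thesis using assms by auto
qed

lemma star_blockE:
  assumes "B \<in> star x"
  obtains y z where "B = {x, y, z}" "x \<noteq> y" "x \<noteq> z" "y \<noteq> z"
proof -
  have "card B = 3" "x \<in> B" using assms card_block by (auto simp: star_def)
  then have "card (B - {x}) = 2" by simp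
  then obtain y z where "B - {x} = {y, z}" "y \<noteq> z" by (auto simp: card_2_iff)
  then have "B = {x, y, z}" "x \<noteq> y" "x \<noteq> z" using \<open>x \<in> B\<close> by auto
  with \<open>y \<noteq> z\<close> show ?thesis using that by blast
qed

lemma star_adjE:
  assumes "adj x w"
  obtains B where "B \<in> star x" "w \<in> B"
  using assms by (auto simp: adj_def covers_def star_def)

text \<open>If {x, y, z} were the only block of \<open>T 1\<close> through \<open>x\<close>, then
  \<open>y\<close> and \<open>z\<close> would be the only neighbours of \<open>x\<close>. The block
  of \<open>T 2\<close> through \<open>x\<close> and \<open>y\<close> would have to be {x, y, z}
  too, against disjointness of the parts.\<close>

lemma card_star_neq_1: "card (star x) \<noteq> 1"
proof
  assume "card (star x) = 1"
  then obtain B where B: "star x = {B}" by (rule card_1_singletonE)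
  then have "B \<in> star x" by simp
  then obtain y z where yz: "B = {x, y, z}" "x \<noteq> y" "x \<noteq> z" "y \<noteq> z" by (rule star_blockE)
  have B1: "B \<in> T 1" using B by (auto simp: star_def)
  have "adj x y" by (rule adj_if_block[of 1 B]) (use yz B1 in auto)
  then obtain w where w: "w \<noteq> x" "w \<noteq> y" "{x, y, w} \<in> T 2" by (rule adjE[of _ _ 2]) auto
  then have "adj x w" by (intro adj_if_block[of 2 "{x, y, w}"]) auto
  then have "w \<in> B" using B by (auto elim: star_adjE)
  then have "{x, y, w} = B" using w yz by auto
  then show False using B1 w trade3_disjoint[OF trade, of 1 2] by auto
qed

text \<open>The three parts induce pairwise disjoint perfect matchings on the four neighbours of \<open>x\<close>;
  as there are only three perfect matchings, every pair of neighbours occurs.\<close>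

lemma adj_across_star:
  assumes s: "star x = {{x, a, b}, {x, c, d}}" and dist: "distinct [x, a, b, c, d]"
  shows "adj a c \<and> adj a d \<and> adj b c \<and> adj b d"
proof -
  have nb: "w \<in> {a, b, c, d}" if "adj x w" for w
  proof -
    obtain B where "B \<in> star x" "w \<in> B" using \<open>adj x w\<close> by (rule star_adjE)
    moreover have "w \<noteq> x" using that by (auto simp: adj_def)
    ultimately show ?thesis using s by auto
  qed
  have B1: "{x, a, b} \<in> T 1" using s by (auto simp: star_def)
  have ab: "adj x a" "adj x b" by (rule adj_if_block[of 1 "{x, a, b}"]; use B1 dist in auto)+
  \<comment> \<open>In the second and third part, neither \<open>a\<close> nor \<open>b\<close> can
    be matched with the other, because {x, a, b} already belongs to \<open>T 1\<close>.\<close>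
  have opp: "\<exists>w\<in>{c, d}. {x, u, w} \<in> T i"
    if i: "i \<in> {2, 3}" and u: "u = a \<or> u = b" for i u
  proof -
    have i3: "i \<in> {1..3}" using i by auto
    have "adj x u" using u ab by auto
    then obtain w where w: "w \<noteq> x" "w \<noteq> u" "{x, u, w} \<in> T i" using adjE i3 by blast
    then have "adj x w" by (intro adj_if_block[OF i3, of "{x, u, w}"]) auto
    then have "w \<in> {a, b, c, d}" by (rule nb)
    moreover have False if "w = a \<or> w = b"
    proof -
      have "{x, u, w} = {x, a, b}" using that w(2) u by auto
      then show False using B1 w(3) i trade3_disjoint[OF trade _ i3, of 1] by auto
    qed
    ultimately show ?thesis using w by auto
  qed
  have uni: "w = z" if "i \<in> {2, 3}" "{x, u, w} \<in> T i" "{x, u, z} \<in> T i" "u \<noteq> x" "w \<noteq> x" "w \<noteq> u" "z \<noteq> x" "z \<noteq> u"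
    for i u w z
    by (rule third_point_unique[of i x u w z]) (use that in auto)
  obtain p where p: "p \<in> {c, d}" "{x, a, p} \<in> T 2" using opp[of 2 a] by blast
  obtain q where q: "q \<in> {c, d}" "{x, a, q} \<in> T 3" using opp[of 3 a] by blast
  obtain p' where p': "p' \<in> {c, d}" "{x, b, p'} \<in> T 2" using opp[of 2 b] by blast
  obtain q' where q': "q' \<in> {c, d}" "{x, b, q'} \<in> T 3" using opp[of 3 b] by blast
  \<comment> \<open>The set {c, d} has just two elements. So \<open>p\<close> and \<open>q\<close>
    exhaust it, which joins \<open>a\<close> to both; \<open>p'\<close> and \<open>q'\<close> are
    then \<open>q\<close> and \<open>p\<close>, which joins \<open>b\<close> to both.\<close>
  have "p \<noteq> q" using p q trade3_disjoint[OF trade, of 2 3] by auto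
  moreover have "p \<noteq> p'"
    using uni[of 2 p a b] p p' dist by (auto simp: insert_commute)
  moreover have "q \<noteq> q'"
    using uni[of 3 q a b] q q' dist by (auto simp: insert_commute)
  moreover have "adj a p" "adj b p'"
    by (rule adj_if_block[of 2 "{x, a, p}"]; use p dist in auto)
      (rule adj_if_block[of 2 "{x, b, p'}"]; use p' dist in auto)
  moreover have "adj a q" "adj b q'"
    by (rule adj_if_block[of 3 "{x, a, q}"]; use q dist in auto)
      (rule adj_if_block[of 3 "{x, b, q'}"]; use q' dist in auto)
  ultimately show ?thesis using p(1) q(1) p'(1) q'(1) by auto
qed

lemma two_le_card_star:
  assumes "B \<in> T 1" "x \<in> B"
  shows "2 \<le> card (star x)"
proof -
  have "star x \<noteq> {}" using assms by (auto simp: star_def)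
  then have "card (star x) \<noteq> 0" using finite_star by simp
  then show ?thesis using card_star_neq_1[of x] by linarith
qed

text \<open>Two different blocks through \<open>x\<close> share no second point, since a pair lies
  in at most one block.\<close>

lemma distinct_if_star:
  assumes "{x, a, b} \<in> T 1" "{x, c, d} \<in> T 1" "{x, a, b} \<noteq> {x, c, d}"
  shows "distinct [x, a, b, c, d]"
proof -
  have "card {x, a, b} = 3" "card {x, c, d} = 3" using assms card_block by auto
  then have ne: "x \<noteq> a" "x \<noteq> b" "a \<noteq> b" "x \<noteq> c" "x \<noteq> d" "c \<noteq> d"
    by (auto simp: card_insert_if split: if_splits)
  have sep: "u \<noteq> v" if "u \<in> {a, b}" "v \<in> {c, d}" for u v
    using block_unique[OF assms(1,2), of x u] assms(3) that ne by auto
  have "a \<noteq> c" "a \<noteq> d" "b \<noteq> c" "b \<noteq> d" by (rule sep; simp)+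
  with ne show ?thesis by simp
qed

section \<open>Trades with a point on exactly two blocks\<close>

lemma third_points_distinct:
  assumes "{p, q, w} \<in> T 1" "{p, r, z} \<in> T 1" "w \<noteq> p" "r \<notin> {p, q, w}"
  shows "w \<noteq> z"
proof
  assume "w = z"
  then have "{p, q, w} = {p, r, z}"
    by (intro block_unique[OF assms(1,2,3)]) auto
  then show False using assms(4) by blast
qed

text \<open>Here \<open>e\<close> lies only in {a, c, e} and \<open>K\<close>, so
  \<open>adj_across_star\<close> applied at \<open>e\<close> joins \<open>a\<close> to the point
  \<open>h\<close> of \<open>K\<close>. None of the seven blocks contains both \<open>a\<close> and
  \<open>h\<close>.\<close>

lemma no_seven_blocks_if_unbalanced:
  assumes T1: "T 1 = {{x, a, b}, {x, c, d}, {a, c, e}, {a, d, f}, {b, c, g}, {b, d, h}, K}"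
    and dist: "distinct [x, a, b, c, d]"
    and out: "{e, f, g, h} \<inter> {x, a, b, c, d} = {}"
    and neq: "e \<noteq> f" "e \<noteq> g" "f \<noteq> h" "g \<noteq> h" "e \<noteq> h"
    and K: "e \<in> K" "h \<in> K"
  shows False
proof -
  have in1: "{a, c, e} \<in> T 1" "K \<in> T 1" by (simp_all add: T1)
  have "K \<in> star e" using in1 K by (simp add: star_def)
  then obtain y z where yz: "K = {e, y, z}" "e \<noteq> y" "e \<noteq> z" "y \<noteq> z" by (rule star_blockE)
  \<comment> \<open>One of \<open>y\<close> and \<open>z\<close> is \<open>h\<close>;
    \<open>k\<close> is the other one, the third point of \<open>K\<close> besides \<open>e\<close>
    and \<open>h\<close>.\<close>
  define k where "k = (if y = h then z else y)"
  have k: "K = {e, h, k}" "k \<noteq> e" "k \<noteq> h" using yz K neq by (auto simp: k_def)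
  have "{e, a, c} \<in> T 1" using in1 by (simp add: insert_commute)
  moreover have "{e, h, k} \<in> T 1" using in1 k by simp
  moreover have "h \<notin> {e, a, c}" using out neq by auto
  then have "{e, a, c} \<noteq> {e, h, k}" by blast
  ultimately have d: "distinct [e, a, c, h, k]" by (rule distinct_if_star)
  have "star e = {{e, a, c}, {e, h, k}}"
    unfolding star_def T1 k using dist out neq by auto
  then have "adj a h" using adj_across_star[OF _ d] by blast
  then obtain B where "B \<in> T 1" "a \<in> B" "h \<in> B" by (auto simp: adj_def covers_def)
  then show False unfolding T1 k using dist out neq d by auto
qed

text \<open>By \<open>adj_across_star\<close> the two blocks at \<open>x\<close> force four more,
  each through one of \<open>a\<close>, \<open>b\<close> and one of \<open>c\<close>,
  \<open>d\<close>. These six blocks give \<open>6 \<le> m\<close>, and the remaining work is to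
  exclude a single additional block \<open>K\<close>.\<close>

lemma card_star_2_imp:
  assumes "card (star x) = 2"
  shows "m = 6 \<or> 8 \<le> m"
proof -
  obtain B1 B2 where B: "star x = {B1, B2}" "B1 \<noteq> B2" using assms by (auto simp: card_2_iff)
  then have "B1 \<in> star x" "B2 \<in> star x" by simp_all
  then obtain a b c d where ab: "B1 = {x, a, b}" and cd: "B2 = {x, c, d}"
    by (elim star_blockE) blast
  have s: "star x = {{x, a, b}, {x, c, d}}" using B ab cd by simp
  have in1: "{x, a, b} \<in> T 1" "{x, c, d} \<in> T 1" using s by (auto simp: star_def)
  have "{x, a, b} \<noteq> {x, c, d}" using B(2) unfolding ab cd .
  then have dist: "distinct [x, a, b, c, d]" using distinct_if_star[OF in1] by blast
  have adj: "adj a c" "adj a d" "adj b c" "adj b d" using adj_across_star[OF s dist] by auto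
  obtain e where e: "e \<noteq> a" "e \<noteq> c" "{a, c, e} \<in> T 1" using adjE[OF adj(1), of 1] by auto
  obtain f where f: "f \<noteq> a" "f \<noteq> d" "{a, d, f} \<in> T 1" using adjE[OF adj(2), of 1] by auto
  obtain g where g: "g \<noteq> b" "g \<noteq> c" "{b, c, g} \<in> T 1" using adjE[OF adj(3), of 1] by auto
  obtain h where h: "h \<noteq> b" "h \<noteq> d" "{b, d, h} \<in> T 1" using adjE[OF adj(4), of 1] by auto
  \<comment> \<open>A third point among the five would give the block two points in common with {x,
    a, b} or with {x, c, d}, so it would coincide with that block.\<close>
  have out1: "w \<notin> {x, a, b, c, d}"
    if "u \<in> {a, b}" "v \<in> {c, d}" "w \<noteq> u" "w \<noteq> v" "{u, v, w} \<in> T 1" for u v w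
  proof
    assume w: "w \<in> {x, a, b, c, d}"
    have "{u, v, w} = {x, a, b}" if "w \<in> {x, a, b}"
      by (rule block_unique[OF \<open>{u, v, w} \<in> T 1\<close> in1(1), of w u])
        (use that \<open>u \<in> {a, b}\<close> \<open>w \<noteq> u\<close> in auto)
    moreover have "{u, v, w} = {x, c, d}" if "w \<in> {c, d}"
      by (rule block_unique[OF \<open>{u, v, w} \<in> T 1\<close> in1(2), of w v])
        (use that \<open>v \<in> {c, d}\<close> \<open>w \<noteq> v\<close> in auto)
    ultimately show False using w that(1,2) dist by auto
  qed
  have out: "{e, f, g, h} \<inter> {x, a, b, c, d} = {}"
    using out1[of a c e] out1[of a d f] out1[of b c g] out1[of b d h] e f g h by auto
  have ef: "e \<noteq> f"
    by (rule third_points_distinct[of a c e d f]) (use e f dist out in auto)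
  have eg: "e \<noteq> g"
    by (rule third_points_distinct[of c a e b g]) (use e g dist out in \<open>auto simp: insert_commute\<close>)
  have fh: "f \<noteq> h"
    by (rule third_points_distinct[of d a f b h]) (use f h dist out in \<open>auto simp: insert_commute\<close>)
  have gh: "g \<noteq> h"
    by (rule third_points_distinct[of b c g d h]) (use g h dist out in auto)
  define S where "S = {{x, a, b}, {x, c, d}, {a, c, e}, {a, d, f}, {b, c, g}, {b, d, h}}"
  have S: "S \<subseteq> T 1" using in1 e f g h by (simp add: S_def)
  \<comment> \<open>Membership of \<open>x\<close>, \<open>a\<close>, \<open>b\<close> and
    \<open>c\<close> alone already tells the six blocks apart.\<close>
  have "distinct (map (\<lambda>B. (x \<in> B, a \<in> B, b \<in> B, c \<in> B))
      [{x, a, b}, {x, c, d}, {a, c, e}, {a, d, f}, {b, c, g}, {b, d, h}])"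
    using dist out by auto
  then have "distinct [{x, a, b}, {x, c, d}, {a, c, e}, {a, d, f}, {b, c, g}, {b, d, h}]"
    by (rule distinct_map[THEN iffD1, THEN conjunct1])
  from distinct_card[OF this] have cS: "card S = 6" by (simp add: S_def)
  have fT: "finite (T 1)" "card (T 1) = m"
    using trade3_finite[OF trade, of 1] trade3_card[OF trade, of 1] by auto
  have "6 \<le> m" using card_mono[OF fT(1) S] cS fT by simp
  moreover have False if m7: "m = 7"
  proof -
    have "card (T 1 - S) = 1"
      using card_Diff_subset[OF finite_subset[OF S fT(1)] S] cS fT m7 by simp
    then obtain K where K: "T 1 - S = {K}" by (rule card_1_singletonE)
    then have "T 1 = S \<union> {K}" using S by blast
    then have T1: "T 1 = {{x, a, b}, {x, c, d}, {a, c, e}, {a, d, f}, {b, c, g}, {b, d, h}, K}"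
      unfolding S_def by (simp only: Un_insert_left Un_empty_left)
    have KT: "K \<in> T 1" "K \<notin> S" using K by auto
    have K3: "card K = 3" "finite K"
      using card_block[OF KT(1)] by (auto intro: card_ge_0_finite)
    have two: "\<exists>B'\<in>T 1. p \<in> B' \<and> B' \<noteq> B" if "B \<in> T 1" "p \<in> B" for p B
    proof (rule ccontr)
      assume "\<not> ?thesis"
      then have "star p = {B}" using that unfolding star_def by blast
      then show False using card_star_neq_1[of p] by simp
    qed
    \<comment> \<open>When \<open>e\<close> and \<open>h\<close> differ, each of them lies in only
      one of the six blocks of \<open>S\<close>; the second block that it needs can only be
      \<open>K\<close>. The same holds below for \<open>f\<close> and \<open>g\<close>.\<close>
    have eh: "e \<in> K \<and> h \<in> K" if "e \<noteq> h"
    proof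
      obtain B where "B \<in> T 1" "e \<in> B" "B \<noteq> {a, c, e}" using two[OF e(3), of e] by auto
      then have "e \<in> {x, a, b} \<or> e \<in> {x, c, d} \<or> e \<in> {a, d, f} \<or>
          e \<in> {b, c, g} \<or> e \<in> {b, d, h} \<or> e \<in> K"
        unfolding T1 by blast
      then show "e \<in> K" using that dist out ef eg fh gh by auto
    next
      obtain B where "B \<in> T 1" "h \<in> B" "B \<noteq> {b, d, h}" using two[OF h(3), of h] by auto
      then have "h \<in> {x, a, b} \<or> h \<in> {x, c, d} \<or> h \<in> {a, c, e} \<or>
          h \<in> {a, d, f} \<or> h \<in> {b, c, g} \<or> h \<in> K"
        unfolding T1 by blast
      then show "h \<in> K" using that dist out ef eg fh gh by auto
    qed
    have fg: "f \<in> K \<and> g \<in> K" if "f \<noteq> g"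
    proof
      obtain B where "B \<in> T 1" "f \<in> B" "B \<noteq> {a, d, f}" using two[OF f(3), of f] by auto
      then have "f \<in> {x, a, b} \<or> f \<in> {x, c, d} \<or> f \<in> {a, c, e} \<or>
          f \<in> {b, c, g} \<or> f \<in> {b, d, h} \<or> f \<in> K"
        unfolding T1 by blast
      then show "f \<in> K" using that dist out ef eg fh gh by auto
    next
      obtain B where "B \<in> T 1" "g \<in> B" "B \<noteq> {b, c, g}" using two[OF g(3), of g] by auto
      then have "g \<in> {x, a, b} \<or> g \<in> {x, c, d} \<or> g \<in> {a, c, e} \<or>
          g \<in> {a, d, f} \<or> g \<in> {b, d, h} \<or> g \<in> K"
        unfolding T1 by blast
      then show "g \<in> K" using that dist out ef eg fh gh by auto
    qed
    consider "e = h" "f = g" | "e \<noteq> h" | "f \<noteq> g" by blast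
    then show False
    proof cases
      case 1
      have "x \<notin> K"
      proof
        assume "x \<in> K"
        then have "K \<in> star x" using KT by (simp add: star_def)
        then have "K \<in> S" unfolding s S_def by (elim insertE emptyE) simp_all
        with KT show False by simp
      qed
      moreover have "K \<subseteq> {x, a, b, c, d, e, f}"
      proof
        fix p assume "p \<in> K"
        then obtain B where "B \<in> T 1" "p \<in> B" "B \<noteq> K" using two[OF KT(1)] by blast
        then have "p \<in> {x, a, b} \<or> p \<in> {x, c, d} \<or> p \<in> {a, c, e} \<or> p \<in> {a, d, f} \<or>
            p \<in> {b, c, g} \<or> p \<in> {b, d, h}"
          unfolding T1 by blast
        then show "p \<in> {x, a, b, c, d, e, f}" using 1 by auto
      qed
      \<comment> \<open>Within these six points, \<open>S\<close> covers every pair except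
        \<open>e\<close> and \<open>f\<close>. Since \<open>K\<close> may not repeat a covered pair,
        it cannot have three points.\<close>
      ultimately have sub: "K \<subseteq> {a, b, c, d, e, f}" by blast
      have not_both: "u \<notin> K \<or> v \<notin> K" if "B \<in> S" "u \<in> B" "v \<in> B" "u \<noteq> v" for B u v
        using block_unique[OF KT(1) subsetD[OF S that(1)], of u v] that KT(2) by blast
      have "K \<subseteq> {e, f} \<or> (\<exists>p. K \<subseteq> {p})"
      proof (cases "K \<subseteq> {e, f}")
        case False
        then obtain p where p: "p \<in> K" "p \<in> {a, b, c, d}" using sub by blast
        have "q \<notin> K" if "q \<in> {a, b, c, d, e, f}" "q \<noteq> p" for q
        proof -
          have "\<exists>B\<in>S. p \<in> B \<and> q \<in> B" using p(2) that 1 unfolding S_def by auto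
          then show ?thesis using not_both p(1) that(2) by blast
        qed
        then have "K \<subseteq> {p}" using sub by blast
        then show ?thesis by blast
      qed simp
      then have "card K \<le> 2"
      proof
        assume "K \<subseteq> {e, f}"
        then have "card K \<le> card {e, f}" by (intro card_mono) auto
        also have "\<dots> \<le> 2" by (simp add: card_insert_if)
        finally show ?thesis .
      next
        assume "\<exists>p. K \<subseteq> {p}"
        then obtain p where "K \<subseteq> {p}" by blast
        then have "card K \<le> card {p}" by (intro card_mono) auto
        then show ?thesis by simp
      qed
      then show False using K3 by simp
    next
      case 2
      then show False
        using no_seven_blocks_if_unbalanced[OF T1 dist out ef eg fh gh] eh by blast
    next
      case 3
      show False
      \<comment> \<open>Exchanging \<open>c\<close> with \<open>d\<close> exchanges \<open>e\<close>
        with \<open>f\<close> and \<open>g\<close> with \<open>h\<close>, which turns this case into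
        the previous one.\<close>
      proof (rule no_seven_blocks_if_unbalanced[of x a b d c f e h g K])
        show "T 1 = {{x, a, b}, {x, d, c}, {a, d, f}, {a, c, e}, {b, d, h}, {b, c, g}, K}"
          unfolding T1 by (simp add: insert_commute)
      qed (use 3 dist out ef eg fh gh fg in auto)
    qed
  qed
  ultimately show ?thesis by (cases "m = 7") auto
qed

section \<open>Trades with every point on at least three blocks\<close>

lemma three_blocksE:
  assumes "3 \<le> card (star x)"
  obtains a b c d e f where "distinct [x, a, b, c, d, e, f]"
    "{x, a, b} \<in> T 1" "{x, c, d} \<in> T 1" "{x, e, f} \<in> T 1"
proof -
  obtain S where "S \<subseteq> star x" "card S = 3" using obtain_subset_with_card_n[OF assms] by blast
  then obtain B1 B2 B3 where B: "B1 \<in> star x" "B2 \<in> star x" "B3 \<in> star x"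
    "B1 \<noteq> B2" "B1 \<noteq> B3" "B2 \<noteq> B3"
    by (auto simp: card_3_iff)
  obtain a b where ab: "B1 = {x, a, b}" using B(1) by (rule star_blockE)
  obtain c d where cd: "B2 = {x, c, d}" using B(2) by (rule star_blockE)
  obtain e f where ef: "B3 = {x, e, f}" using B(3) by (rule star_blockE)
  have in1: "{x, a, b} \<in> T 1" "{x, c, d} \<in> T 1" "{x, e, f} \<in> T 1"
    using B ab cd ef by (auto simp: star_def)
  have "{x, a, b} \<noteq> {x, c, d}" "{x, a, b} \<noteq> {x, e, f}" "{x, c, d} \<noteq> {x, e, f}"
    using B(4-6) unfolding ab cd ef .
  then have "distinct [x, a, b, c, d]" "distinct [x, a, b, e, f]" "distinct [x, c, d, e, f]"
    using distinct_if_star in1 by blast+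
  then have "distinct [x, a, b, c, d, e, f]" by auto
  with in1 show ?thesis using that by blast
qed

text \<open>Counting incidences gives \<open>3 * card V \<le> 3 * m\<close>, while three blocks
  through one point span seven points; so \<open>7 \<le> card V\<close> and
  \<open>card V \<le> m\<close>. If \<open>m = 7\<close>, then \<open>V\<close> has exactly seven
  points and all pairs are covered, which is the situation of
  \<open>no_three_disjoint_fano_planes\<close>.\<close>

lemma all_stars_large_imp:
  assumes large: "\<And>x. x \<in> \<Union>(T 1) \<Longrightarrow> 3 \<le> card (star x)" and m: "0 < m"
  shows "8 \<le> m"
proof -
  define V where "V = \<Union>(T 1)"
  have fT: "finite (T 1)" "card (T 1) = m"
    using trade3_finite[OF trade, of 1] trade3_card[OF trade, of 1] by auto
  have "finite B" if "B \<in> T 1" for B using card_block[OF that] by (simp add: card_ge_0_finite)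
  then have fV: "finite V" unfolding V_def using fT(1) by blast
  have "(\<Sum>x\<in>V. card {B \<in> T 1. x \<in> B}) = 3 * card (T 1)"
  proof (rule sum_multicount[OF fV fT(1)])
    have "{x \<in> V. x \<in> B} = B" if "B \<in> T 1" for B using that by (auto simp: V_def)
    then show "\<forall>B\<in>T 1. card {x \<in> V. x \<in> B} = 3" using card_block by simp
  qed
  moreover have "(\<Sum>x\<in>V. 3) \<le> (\<Sum>x\<in>V. card {B \<in> T 1. x \<in> B})"
    using large by (intro sum_mono) (simp add: V_def star_def)
  ultimately have Vm: "card V \<le> m" using fT by simp
  have star3: "3 \<le> card (star x)" if "x \<in> V" for x using that large by (simp add: V_def)
  have "T 1 \<noteq> {}" using fT m by auto
  then obtain B where "B \<in> T 1" by blast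
  then have "B \<noteq> {}" using card_block[of B] by auto
  then obtain x where x: "x \<in> V" using \<open>B \<in> T 1\<close> by (auto simp: V_def)
  obtain a b c d e f where D: "distinct [x, a, b, c, d, e, f]"
    and bl: "{x, a, b} \<in> T 1" "{x, c, d} \<in> T 1" "{x, e, f} \<in> T 1"
    using star3[OF x] by (rule three_blocksE)
  then have sub: "{x, a, b, c, d, e, f} \<subseteq> V" unfolding V_def by blast
  have seven: "card {x, a, b, c, d, e, f} = 7" using distinct_card[OF D] by simp
  then have "7 \<le> card V" using card_mono[OF fV sub] by simp
  then have "7 \<le> m" using Vm by simp
  moreover have False if m7: "m = 7"
  proof -
    have V7: "card V \<le> 7" using Vm m7 by simp
    \<comment> \<open>Three blocks through \<open>u\<close> span seven points and hence all of
      \<open>V\<close>, so one of them contains \<open>v\<close>.\<close>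
    have adj: "adj u v" if "u \<in> V" "v \<in> V" "u \<noteq> v" for u v
    proof -
      obtain a b c d e f where D: "distinct [u, a, b, c, d, e, f]"
        and bl: "{u, a, b} \<in> T 1" "{u, c, d} \<in> T 1" "{u, e, f} \<in> T 1"
        using star3[OF \<open>u \<in> V\<close>] by (rule three_blocksE)
      then have sub: "{u, a, b, c, d, e, f} \<subseteq> V" unfolding V_def by blast
      have "{u, a, b, c, d, e, f} = V"
        using card_seteq[OF fV sub] V7 distinct_card[OF D] by simp
      then consider "v \<in> {u, a, b}" | "v \<in> {u, c, d}" | "v \<in> {u, e, f}" using \<open>v \<in> V\<close> by blast
      then show ?thesis
      proof cases
        case 1
        then show ?thesis using adj_if_block[of 1, OF _ bl(1)] that(3) by simp
      next
        case 2
        then show ?thesis using adj_if_block[of 1, OF _ bl(2)] that(3) by simp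
      next
        case 3
        then show ?thesis using adj_if_block[of 1, OF _ bl(3)] that(3) by simp
      qed
    qed
    have V: "V = {x, a, b, c, d, e, f}"
      using card_seteq[OF fV sub] V7 seven by simp
    have idx: "\<exists>i\<in>{1..3}. X = T i" if "X \<in> {T 1, T 2, T 3}" for X using that by auto
    show False
    proof (rule no_three_disjoint_fano_planes[OF V D _ _ _ _ _ bl])
      fix X u v assume X: "X \<in> {T 1, T 2, T 3}" and uv: "u \<in> V" "v \<in> V" "u \<noteq> v"
      obtain i where i: "i \<in> {1..3}" "X = T i" using idx[OF X] by blast
      obtain w where w: "w \<noteq> u" "w \<noteq> v" "{u, v, w} \<in> T i" using adjE[OF adj[OF uv] i(1)] by blast
      then have "adj u w" by (intro adj_if_block[OF i(1), of "{u, v, w}"]) auto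
      then have "w \<in> V" by (auto simp: adj_def covers_def V_def)
      then show "\<exists>w\<in>V. w \<noteq> u \<and> w \<noteq> v \<and> {u, v, w} \<in> X" using w i by blast
    next
      fix X u v w z assume X: "X \<in> {T 1, T 2, T 3}" and uv: "u \<noteq> v" "{u, v, w} \<in> X" "{u, v, z} \<in> X"
        "w \<noteq> u" "w \<noteq> v" "z \<noteq> u" "z \<noteq> v"
      show "w = z" using idx[OF X] third_point_unique uv by blast
    qed (use trade3_disjoint[OF trade] in auto)
  qed
  ultimately show ?thesis by (cases "m = 7") auto
qed

lemma volume:
  assumes "0 < m"
  shows "m = 6 \<or> 8 \<le> m"
proof (cases "\<exists>x. card (star x) = 2")
  case True
  then show ?thesis using card_star_2_imp by blast
next
  case False
  have "3 \<le> card (star x)" if "x \<in> \<Union>(T 1)" for x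
  proof -
    have "2 \<le> card (star x)" using that two_le_card_star by blast
    then show ?thesis using False by (metis One_nat_def Suc_1 le_antisym not_less_eq_eq numeral_3_eq_3)
  qed
  then show ?thesis using all_stars_large_imp assms by blast
qed

end

theorem theorem3p6:
  shows "steiner_volumes 3 2 3 = {1..} - {1, 2, 3, 4, 5, 7}"
proof (intro equalityI subsetI)
  fix m assume "m \<in> steiner_volumes 3 2 3"
  then obtain T :: "nat \<Rightarrow> nat set set" where "0 < m" "trade3 m T"
    by (auto simp: mem_steiner_volumes_iff)
  then show "m \<in> {1..} - {1, 2, 3, 4, 5, 7}"
    using three_way_trade.volume[of T m] by (auto simp: three_way_trade_def)
next
  fix m :: nat assume "m \<in> {1..} - {1, 2, 3, 4, 5, 7}"
  then have "m = 6 \<or> 8 \<le> m" by auto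
  then show "m \<in> steiner_volumes 3 2 3"
    using steiner_volumes_6 steiner_volumes_if_ge_8 by blast
qed

end
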